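(* Let $D$ be the Borwein--Dykshoorn function and let ${\mathcal S}_2$ be the Kurokawa double sine function. Then the following equality holds, as an identity of meromorphic functions of $x \in \mathbb{C}$: $$\frac{D(x)}{D(-x)} = e^x \, \frac{{\mathcal S}_2(x/2)^4}{{\mathcal S}_2(x)}.$$
   Context: The Borwein--Dykshoorn function is defined by $$D(x) = \lim_{n \to \infty} \prod_{k=1}^{2n+1} \left(1+\frac{x}{k}\right)^{k(-1)^{k+1}},$$ and it extends to a meromorphic function on $\mathbb{C}$ with poles at the negative even integers. The Kurokawa double sine function is $${\mathcal S}_2(z) = e^z \prod_{n \geq 1} \left(\left(\frac{1 - \frac{z}{n}}{1 + \frac{z}{n}}\right)^n e^{2z}\right),$$ a meromorphic function on $\mathbb{C}$. All exponents in both products are integers. *)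

theory Defs
  imports "HOL-Complex_Analysis.Complex_Analysis"
begin

text \<open>
  Both functions below are given directly by their limit or product formula at every complex
  number that is not a pole. The poles are the negative even integers for the first function and
  the negative integers for the second; there a factor \<open>0 powi (- m)\<close> respectively \<open>(2 / 0) ^ n\<close>
  occurs, so that the formulas return \<open>0\<close>, which is the value the library conventionally assigns
  to a meromorphic function at a pole. The values at zeros are the genuine ones.
\<close>

definition borwein_dykshoorn :: "complex \<Rightarrow> complex" where
  "borwein_dykshoorn x =
     lim (\<lambda>n. \<Prod>k=1..2*n+1. (1 + x / of_nat k) powi (int k * (-1) ^ (k + 1)))"

text \<open>The product over \<open>n \<ge> 1\<close> is indexed by \<open>Suc n\<close>, since \<^const>\<open>prodinf\<close> starts at \<open>0\<close>.\<close>

definition double_sine :: "complex \<Rightarrow> complex" where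
  "double_sine z =
     exp z * prodinf (\<lambda>n. ((1 - z / of_nat (Suc n)) / (1 + z / of_nat (Suc n))) ^ Suc n
                            * exp (2 * z))"

end

theory Submission
  imports Defs
begin

text \<open>
  Writing \<open>r\<^sub>k x = (1 - x/k) / (1 + x/k)\<close>, the quotient \<open>D x / D (-x)\<close> is the limit of the products
  of \<open>r\<^sub>k x\<close> to the power \<open>(-1)^k * k\<close>. Splitting off the even \<open>k\<close> and using
  \<open>r\<^sub>2\<^sub>j x = r\<^sub>j (x/2)\<close>, the partial product becomes the quotient of the partial products of
  \<open>\<S>\<^sub>2 (x/2)^4\<close> and \<open>\<S>\<^sub>2 x\<close> up to an exponential factor.
  Both functions are meromorphic because, after pairing consecutive factors of \<open>D\<close>, all but
  finitely many factors on a given disc are exponentials of holomorphic functions of size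
  \<open>O(1/n\<^sup>2)\<close>.
\<close>

section \<open>Infinite products of meromorphic functions\<close>

lemma holomorphic_on_suminf:
  fixes g :: "nat \<Rightarrow> complex \<Rightarrow> complex"
  assumes "open S" and "\<And>n. g n holomorphic_on S"
    and "\<And>n z. z \<in> S \<Longrightarrow> norm (g n z) \<le> M n" and "summable M"
  shows "(\<lambda>z. \<Sum>n. g n z) holomorphic_on S"
proof (rule holomorphic_uniform_sequence [OF \<open>open S\<close>])
  show "(\<lambda>z. \<Sum>i<n. g i z) holomorphic_on S" for n
    by (intro holomorphic_intros assms)
next
  fix x assume "x \<in> S"
  then obtain d where d: "d > 0" "cball x d \<subseteq> S"
    using \<open>open S\<close> open_contains_cball by blast
  have "uniform_limit S (\<lambda>n z. \<Sum>i<n. g i z) (\<lambda>z. \<Sum>n. g n z) sequentially"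
    using assms by (intro Weierstrass_m_test) auto
  with d show "\<exists>d>0. cball x d \<subseteq> S \<and>
      uniform_limit (cball x d) (\<lambda>n z. \<Sum>i<n. g i z) (\<lambda>z. \<Sum>n. g n z) sequentially"
    using uniform_limit_on_subset by blast
qed

text \<open>Only the tail has to consist of exponentials; the first \<open>N\<close> factors may
  vanish. Convergence holds because the tail products have the nonzero limit
  \<open>exp (suminf g)\<close>.\<close>

lemma prodinf_exp_tail:
  fixes f :: "nat \<Rightarrow> 'a :: {real_normed_field, banach}"
  assumes f: "\<And>n. f (n + N) = exp (g n)" and g: "summable g"
  shows "convergent_prod f" and "prodinf f = (\<Prod>i<N. f i) * exp (suminf g)"
proof -
  have "raw_has_prod (\<lambda>i. f (i + N)) 0 (exp (suminf g))"
    using sums_imp_has_prod_exp [OF summable_sums [OF g]] f by simp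
  hence raw: "raw_has_prod f N (exp (suminf g))"
    by (simp add: raw_has_prod_def)
  thus conv: "convergent_prod f"
    by (auto simp: convergent_prod_def)
  have "(\<lambda>n. (\<Prod>i<N. f i) * (\<Prod>i\<le>n. f (i + N))) \<longlonglongrightarrow> (\<Prod>i<N. f i) * exp (suminf g)"
    using raw by (intro tendsto_mult tendsto_const) (simp add: raw_has_prod_def)
  moreover have "(\<Prod>i<N. f i) * (\<Prod>i\<le>n. f (i + N)) = (\<Prod>i\<le>n + N. f i)" for n
  proof (induction n)
    case 0
    then show ?case by (simp flip: lessThan_Suc_atMost)
  next
    case (Suc n)
    then show ?case by (simp flip: mult.assoc)
  qed
  ultimately have "(\<lambda>n. \<Prod>i\<le>n + N. f i) \<longlonglongrightarrow> (\<Prod>i<N. f i) * exp (suminf g)"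
    by simp
  moreover have "(\<lambda>n. \<Prod>i\<le>n + N. f i) \<longlonglongrightarrow> prodinf f"
    using LIMSEQ_ignore_initial_segment [OF convergent_prod_LIMSEQ [OF conv]] .
  ultimately show "prodinf f = (\<Prod>i<N. f i) * exp (suminf g)"
    using LIMSEQ_unique by blast
qed

context
  fixes f :: "nat \<Rightarrow> complex \<Rightarrow> complex"
  assumes f_eq_exp: "\<And>R. R > 0 \<Longrightarrow> \<exists>g C N. \<forall>n\<ge>N. g n holomorphic_on ball 0 R \<and>
    (\<forall>z\<in>ball 0 R. f n z = exp (g n z) \<and> norm (g n z) \<le> C / real n ^ 2)"
begin

text \<open>\<open>G\<close> is the sum of the tail logarithms, holomorphic by the M-test, so zeros
  and poles in the ball can come only from the finite head. The cutoff \<open>N\<close> depends on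
  \<open>R\<close>.\<close>

lemma prodinf_on_ball:
  assumes "R > 0"
  obtains N G where "G holomorphic_on ball 0 R"
    and "\<And>z. z \<in> ball 0 R \<Longrightarrow> convergent_prod (\<lambda>n. f n z)"
    and "\<And>z. z \<in> ball 0 R \<Longrightarrow> prodinf (\<lambda>n. f n z) = (\<Prod>i<N. f i z) * exp (G z)"
proof -
  obtain g C N where g: "\<And>n. n \<ge> N \<Longrightarrow> g n holomorphic_on ball 0 R"
    and f: "\<And>n z. n \<ge> N \<Longrightarrow> z \<in> ball 0 R \<Longrightarrow> f n z = exp (g n z)"
    and le: "\<And>n z. n \<ge> N \<Longrightarrow> z \<in> ball 0 R \<Longrightarrow> norm (g n z) \<le> C / real n ^ 2"
    using f_eq_exp [OF assms] by blast
  define M where "M n = C / real (n + N) ^ 2" for n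
  have "summable (\<lambda>n. C * inverse (real n ^ 2))"
    by (intro summable_mult inverse_power_summable) simp
  hence M: "summable M"
    unfolding M_def summable_iff_shift [of "\<lambda>n. C / real n ^ 2"] by (simp add: divide_inverse)
  have bound: "norm (g (n + N) z) \<le> M n" if "z \<in> ball 0 R" for n z
    unfolding M_def by (rule le) (use that in simp_all)
  have sum: "summable (\<lambda>n. g (n + N) z)" if "z \<in> ball 0 R" for z
    by (rule summable_comparison_test' [OF M]) (rule bound [OF that])
  show ?thesis
  proof
    show "(\<lambda>z. \<Sum>n. g (n + N) z) holomorphic_on ball 0 R"
      using bound M g by (intro holomorphic_on_suminf [where M = M]) auto
    show "convergent_prod (\<lambda>n. f n z)" if "z \<in> ball 0 R" for z
      using that by (intro prodinf_exp_tail(1) [OF _ sum [OF that], where N = N] f) auto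
    show "prodinf (\<lambda>n. f n z) = (\<Prod>i<N. f i z) * exp (\<Sum>n. g (n + N) z)"
      if "z \<in> ball 0 R" for z
      using that by (intro prodinf_exp_tail(2) [OF _ sum [OF that], where N = N] f) auto
  qed
qed

lemma convergent_prod_entire: "convergent_prod (\<lambda>n. f n z)"
proof -
  have "norm z + 1 > 0"
    by (simp add: add_nonneg_pos)
  from prodinf_on_ball [OF this] show ?thesis
    by (metis dist_0_norm less_add_one mem_ball)
qed

text \<open>Meromorphy is local, and on a ball containing \<open>z\<close> the product is a finite
  product of meromorphic functions times the exponential of a holomorphic one.\<close>

lemma prodinf_meromorphic:
  assumes mero: "\<And>n. f n meromorphic_on UNIV"
  shows "(\<lambda>z. prodinf (\<lambda>n. f n z)) meromorphic_on UNIV"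
  unfolding meromorphic_on_def
proof
  fix z :: complex
  define R where "R = norm z + 1"
  have "R > 0"
    by (simp add: R_def add_nonneg_pos)
  then obtain N G where G: "G holomorphic_on ball 0 R"
    and eq: "\<And>z. z \<in> ball 0 R \<Longrightarrow> prodinf (\<lambda>n. f n z) = (\<Prod>i<N. f i z) * exp (G z)"
    using prodinf_on_ball by metis
  have "(\<lambda>z. (\<Prod>i<N. f i z) * exp (G z)) meromorphic_on ball 0 R"
    by (intro meromorphic_on_mult meromorphic_on_prod meromorphic_on_subset [OF mero]
          analytic_on_imp_meromorphic_on)
      (use G in \<open>auto simp: analytic_on_open intro!: holomorphic_intros\<close>)
  also have "?this \<longleftrightarrow> (\<lambda>z. prodinf (\<lambda>n. f n z)) meromorphic_on ball 0 R"
  proof (rule meromorphic_on_cong)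
    fix w :: complex assume "w \<in> ball 0 R"
    hence "eventually (\<lambda>z. z \<in> ball 0 R) (at w)"
      by (intro eventually_at_in_open') auto
    thus "eventually (\<lambda>w. (\<Prod>i<N. f i w) * exp (G w) = prodinf (\<lambda>n. f n w)) (at w)"
      by eventually_elim (simp add: eq)
  qed auto
  finally show "\<exists>F. (\<lambda>w. prodinf (\<lambda>n. f n (z + w))) has_laurent_expansion F"
    unfolding meromorphic_on_def by (simp add: R_def)
qed

end

section \<open>Logarithms of the factors\<close>

text \<open>Mean value inequality on the disc of radius \<open>norm w\<close>: there the derivative
  \<open>u\<^sup>2 / (1 + u)\<close> is at most \<open>2 * norm w ^ 2\<close>, since
  \<open>norm (1 + u) \<ge> 1 / 2\<close>.\<close>

lemma norm_Ln_1_plus_minus_quadratic_le: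
  assumes "norm (w :: complex) \<le> 1 / 2"
  shows "norm (Ln (1 + w) - w + w\<^sup>2 / 2) \<le> 2 * norm w ^ 3"
proof -
  define S where "S = cball (0 :: complex) (norm w)"
  have ge: "norm (1 + u) \<ge> 1 / 2" if "u \<in> S" for u
    using that assms norm_triangle_ineq2 [of 1 "- u"] by (auto simp: S_def)
  have "norm ((Ln (1 + w) - w + w\<^sup>2 / 2) - (Ln (1 + 0) - 0 + 0\<^sup>2 / 2))
          \<le> (2 * norm w ^ 2) * norm (w - 0)"
  proof (rule field_differentiable_bound [where S = S and f' = "\<lambda>u. u\<^sup>2 / (1 + u)"])
    fix u assume u: "u \<in> S"
    have "Re (1 + u) > 0"
      using u assms abs_Re_le_cmod [of u] by (auto simp: S_def)
    hence "1 + u \<notin> \<real>\<^sub>\<le>\<^sub>0" "1 + u \<noteq> 0"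
      by (auto simp: complex_nonpos_Reals_iff complex_eq_iff)
    moreover have "inverse (1 + u) - 1 + u = u\<^sup>2 / (1 + u)"
      using \<open>1 + u \<noteq> 0\<close> by (simp add: field_simps power2_eq_square)
    moreover have "((\<lambda>u. Ln (1 + u) - u + u\<^sup>2 / 2) has_field_derivative inverse (1 + u) - 1 + u) (at u within S)"
      by (rule derivative_eq_intros \<open>1 + u \<notin> \<real>\<^sub>\<le>\<^sub>0\<close> refl | simp)+
    ultimately show "((\<lambda>u. Ln (1 + u) - u + u\<^sup>2 / 2) has_field_derivative u\<^sup>2 / (1 + u)) (at u within S)"
      by simp
    have "norm u ^ 2 / norm (1 + u) \<le> norm w ^ 2 / (1 / 2)"
      using u ge [OF u] by (intro frac_le power_mono) (auto simp: S_def)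
    thus "norm (u\<^sup>2 / (1 + u)) \<le> 2 * norm w ^ 2"
      by (simp add: norm_divide norm_power)
  qed (auto simp: S_def)
  thus ?thesis
    by (simp add: power3_eq_cube power2_eq_square mult.assoc)
qed

context
  fixes m :: nat and R :: real
  assumes m: "m > 0" "2 * R \<le> real m"
begin

text \<open>The assumption \<open>2 * R \<le> real m\<close> keeps the argument of \<open>Ln\<close>
  in the right half-plane, away from the branch cut.\<close>

lemma Ln_1_plus_domain:
  assumes "x \<in> ball (0 :: complex) R"
  shows "1 + x / of_nat m \<notin> \<real>\<^sub>\<le>\<^sub>0" and "norm (x / of_nat m) \<le> 1 / 2"
proof -
  show le: "norm (x / of_nat m) \<le> 1 / 2"
    using assms m by (simp add: norm_divide field_simps)
  have "Re (1 + x / of_nat m) > 0"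
    using le abs_Re_le_cmod [of "x / of_nat m"] unfolding plus_complex.sel one_complex.sel by linarith
  thus "1 + x / of_nat m \<notin> \<real>\<^sub>\<le>\<^sub>0"
    by (auto simp: complex_nonpos_Reals_iff)
qed

lemma Ln_1_plus_holomorphic: "(\<lambda>x. of_nat m * Ln (1 + x / of_nat m)) holomorphic_on ball 0 R"
  using Ln_1_plus_domain(1) m by (auto intro!: holomorphic_intros)

lemma exp_Ln_1_plus:
  assumes "x \<in> ball (0 :: complex) R"
  shows "exp (of_nat m * Ln (1 + x / of_nat m)) = (1 + x / of_nat m) ^ m"
proof -
  have "1 + x / of_nat m \<noteq> 0"
    using Ln_1_plus_domain(1) [OF assms] by force
  thus ?thesis
    by (simp only: exp_of_nat_mult exp_Ln not_False_eq_True)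
qed

text \<open>Multiplying the cubic remainder by \<open>m\<close> leaves O(1/m^2), which is summable.
  The quadratic term is only O(1/m) and is left to cancel between two such logarithms.\<close>

lemma Ln_1_plus_bound:
  assumes "x \<in> ball (0 :: complex) R"
  shows "norm (of_nat m * Ln (1 + x / of_nat m) - x + x\<^sup>2 / (2 * of_nat m)) \<le> 2 * R ^ 3 / real m ^ 2"
proof -
  let ?w = "x / of_nat m"
  have "of_nat m * Ln (1 + ?w) - x + x\<^sup>2 / (2 * of_nat m) = of_nat m * (Ln (1 + ?w) - ?w + ?w\<^sup>2 / 2)"
    using m by (simp add: field_simps power2_eq_square)
  also have "norm \<dots> \<le> real m * (2 * norm ?w ^ 3)"
    unfolding norm_mult norm_of_nat
    by (intro mult_left_mono norm_Ln_1_plus_minus_quadratic_le Ln_1_plus_domain(2) assms) auto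
  also have "\<dots> = 2 * norm x ^ 3 / real m ^ 2"
    using m by (simp add: norm_divide field_simps power3_eq_cube power2_eq_square)
  also have "\<dots> \<le> 2 * R ^ 3 / real m ^ 2"
    using assms by (intro divide_right_mono mult_left_mono power_mono) auto
  finally show ?thesis .
qed

end

section \<open>The two functions as products\<close>

definition bd_factor :: "nat \<Rightarrow> complex \<Rightarrow> complex" where
  "bd_factor k x = (1 + x / of_nat k) powi (int k * (-1) ^ (k + 1))"

text \<open>For \<open>n = 0\<close> this is \<open>1 + x\<close>, since \<open>bd_factor 0 x = 1\<close>.\<close>

definition bd_pair :: "nat \<Rightarrow> complex \<Rightarrow> complex" where
  "bd_pair n x = bd_factor (2 * n) x * bd_factor (2 * n + 1) x"

definition ds_factor :: "nat \<Rightarrow> complex \<Rightarrow> complex" where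
  "ds_factor n z = ((1 - z / of_nat (Suc n)) / (1 + z / of_nat (Suc n))) ^ Suc n * exp (2 * z)"

lemma bd_pair_eq:
  "bd_pair n x =
     (1 + x / of_nat (2 * n + 1)) ^ (2 * n + 1) / (1 + x / of_nat (2 * n)) ^ (2 * n)"
proof -
  have "int (2 * n) * (-1) ^ (2 * n + 1) = - int (2 * n)"
    by simp
  hence even: "bd_factor (2 * n) x = inverse ((1 + x / of_nat (2 * n)) ^ (2 * n))"
    unfolding bd_factor_def by (simp only: power_int_minus power_int_of_nat)
  have "int (2 * n + 1) * (-1) ^ (2 * n + 1 + 1) = int (2 * n + 1)"
    by simp
  hence odd: "bd_factor (2 * n + 1) x = (1 + x / of_nat (2 * n + 1)) ^ (2 * n + 1)"
    unfolding bd_factor_def by (simp only: power_int_of_nat)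
  show ?thesis
    unfolding bd_pair_def even odd divide_inverse by (rule mult.commute)
qed

text \<open>The odd upper bound completes the last pair, and pair 0 only adds the factor
  \<open>bd_factor 0 x = 1\<close>.\<close>

lemma prod_bd_factor: "(\<Prod>k=1..2*n+1. bd_factor k x) = (\<Prod>j\<le>n. bd_pair j x)"
proof (induction n)
  case 0
  then show ?case by (simp add: bd_pair_def bd_factor_def)
next
  case (Suc n)
  then show ?case by (simp add: bd_pair_def mult.assoc)
qed

text \<open>In the difference of the two logarithms the linear terms cancel and the quadratic ones
  leave z^2/(4n(2n+1)). Together with two cubic remainders this gives the constant
  \<open>4 * R ^ 3 + R ^ 2\<close>.\<close>

lemma bd_pair_eq_exp:
  assumes "R > 0"
  shows "\<exists>g C N. \<forall>n\<ge>N. g n holomorphic_on ball 0 R \<and>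
    (\<forall>z\<in>ball 0 R. bd_pair n z = exp (g n z) \<and> norm (g n z) \<le> C / real n ^ 2)"
proof -
  define L where "L m x = of_nat m * Ln (1 + x / of_nat m)" for m :: nat and x :: complex
  define N where "N = Suc (nat \<lceil>R\<rceil>)"
  have "(\<lambda>x. L (2*n+1) x - L (2*n) x) holomorphic_on ball 0 R \<and>
     (\<forall>z\<in>ball 0 R. bd_pair n z = exp (L (2*n+1) z - L (2*n) z) \<and>
        norm (L (2*n+1) z - L (2*n) z) \<le> (4 * R ^ 3 + R ^ 2) / real n ^ 2)" if n: "n \<ge> N" for n
  proof -
    have "n > 0" and "R \<le> real n"
      using n by (simp_all add: N_def) linarith
    hence e: "2 * n > 0" "2 * R \<le> real (2 * n)" and o: "2 * n + 1 > 0" "2 * R \<le> real (2 * n + 1)"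
      by auto
    show ?thesis
    proof (intro conjI ballI)
      show "(\<lambda>x. L (2*n+1) x - L (2*n) x) holomorphic_on ball 0 R"
        unfolding L_def
        by (intro holomorphic_on_diff Ln_1_plus_holomorphic e o)
    next
      fix z :: complex assume z: "z \<in> ball 0 R"
      show "bd_pair n z = exp (L (2*n+1) z - L (2*n) z)"
        unfolding bd_pair_eq exp_diff L_def exp_Ln_1_plus [OF e z] exp_Ln_1_plus [OF o z] ..
      \<comment> \<open>\<open>E\<close> is the third-order remainder of a logarithm;
        \<open>q\<close> collects what the quadratic terms leave.\<close>
      define E where "E m = L m z - z + z\<^sup>2 / (2 * of_nat m)" for m
      define q where "q = z\<^sup>2 / (2 * of_nat (2*n)) - z\<^sup>2 / (2 * of_nat (2*n+1))"
      have "norm (E (2*n)) \<le> 2 * R ^ 3 / real (2*n) ^ 2"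
        unfolding E_def L_def by (rule Ln_1_plus_bound [OF e z])
      also have "\<dots> \<le> 2 * R ^ 3 / real n ^ 2"
        using \<open>n > 0\<close> \<open>R > 0\<close> by (intro frac_le power_mono) auto
      finally have 1: "norm (E (2*n)) \<le> 2 * R ^ 3 / real n ^ 2" .
      have "norm (E (2*n+1)) \<le> 2 * R ^ 3 / real (2*n+1) ^ 2"
        unfolding E_def L_def by (rule Ln_1_plus_bound [OF o z])
      also have "\<dots> \<le> 2 * R ^ 3 / real n ^ 2"
        using \<open>n > 0\<close> \<open>R > 0\<close> by (intro frac_le power_mono) auto
      finally have 2: "norm (E (2*n+1)) \<le> 2 * R ^ 3 / real n ^ 2" .
      define a where "a = (of_nat n :: complex)"
      have nz: "a \<noteq> 0" "2 * a + 1 \<noteq> 0"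
        using \<open>n > 0\<close> of_nat_neq_0 [of "2*n", where 'a = complex] by (simp_all add: a_def add.commute)
      have "z\<^sup>2 / (2 * (2 * a)) - z\<^sup>2 / (2 * (2 * a + 1)) = z\<^sup>2 / (4 * a * (2 * a + 1))"
      proof -
        have "4 * a + 2 = 2 * (2 * a + 1)"
          by simp
        hence "4 * a + 2 \<noteq> 0"
          using nz(2) by (metis mult_eq_0_iff zero_neq_numeral)
        with nz show ?thesis
          by (simp add: divide_simps) (simp add: algebra_simps)
      qed
      hence "q = z\<^sup>2 / of_nat (4 * n * (2*n+1))"
        by (simp only: q_def a_def of_nat_mult of_nat_add of_nat_numeral of_nat_1)
      hence "norm q = norm z ^ 2 / real (4 * n * (2*n+1))"
        by (simp only: norm_divide norm_power norm_of_nat)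
      also have "\<dots> \<le> R ^ 2 / real n ^ 2"
      proof (intro frac_le power_mono)
        have "n * n \<le> 4 * n * (2 * n + 1)" by (intro mult_le_mono) auto
        thus "real n ^ 2 \<le> real (4 * n * (2*n+1))"
          unfolding power2_eq_square of_nat_mult [symmetric] of_nat_le_iff .
      qed (use z \<open>n > 0\<close> in auto)
      finally have 3: "norm q \<le> R ^ 2 / real n ^ 2" .
      have "L (2*n+1) z - L (2*n) z = E (2*n+1) - E (2*n) + q"
        by (simp add: E_def q_def)
      also have "norm \<dots> \<le> norm (E (2*n+1)) + norm (E (2*n)) + norm q"
        by (meson norm_triangle_ineq norm_triangle_ineq4 add_right_mono order_trans)
      also have "\<dots> \<le> 2 * R ^ 3 / real n ^ 2 + 2 * R ^ 3 / real n ^ 2 + R ^ 2 / real n ^ 2"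
        by (intro add_mono 1 2 3)
      also have "\<dots> = (4 * R ^ 3 + R ^ 2) / real n ^ 2"
        by (simp add: add_divide_distrib)
      finally show "norm (L (2*n+1) z - L (2*n) z) \<le> (4 * R ^ 3 + R ^ 2) / real n ^ 2" .
    qed
  qed
  thus ?thesis
    by (intro exI [of _ "\<lambda>n x. L (2*n+1) x - L (2*n) x"]) blast
qed

text \<open>The logarithms at \<open>- z\<close> and \<open>z\<close> have the same quadratic term,
  which cancels in their difference; the linear terms give \<open>- 2 * z\<close>, compensated by
  \<open>exp (2 * z)\<close>. Two cubic remainders are left.\<close>

lemma ds_factor_eq_exp:
  assumes "R > 0"
  shows "\<exists>g C N. \<forall>n\<ge>N. g n holomorphic_on ball 0 R \<and>
    (\<forall>z\<in>ball 0 R. ds_factor n z = exp (g n z) \<and> norm (g n z) \<le> C / real n ^ 2)"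
proof -
  define L where "L m x = of_nat m * Ln (1 + x / of_nat m)" for m :: nat and x :: complex
  \<comment> \<open>Here \<open>z\<close> is divided by \<open>Suc n\<close> instead of
    \<open>2 * n\<close>, so the cutoff is at \<open>2 * R\<close> rather than
    \<open>R\<close>.\<close>
  define N where "N = Suc (nat \<lceil>2 * R\<rceil>)"
  have "(\<lambda>x. L (Suc n) (- x) - L (Suc n) x + 2 * x) holomorphic_on ball 0 R \<and>
     (\<forall>z\<in>ball 0 R. ds_factor n z = exp (L (Suc n) (- z) - L (Suc n) z + 2 * z) \<and>
        norm (L (Suc n) (- z) - L (Suc n) z + 2 * z) \<le> (4 * R ^ 3) / real n ^ 2)" if n: "n \<ge> N" for n
  proof -
    have m: "Suc n > 0" "2 * R \<le> real (Suc n)" and "n > 0"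
      using n by (simp_all add: N_def) linarith
    show ?thesis
    proof (intro conjI ballI)
      have "(L (Suc n) \<circ> uminus) holomorphic_on ball 0 R"
        unfolding L_def
        by (rule holomorphic_on_compose_gen [OF _ Ln_1_plus_holomorphic [OF m]])
          (auto intro!: holomorphic_intros)
      thus "(\<lambda>x. L (Suc n) (- x) - L (Suc n) x + 2 * x) holomorphic_on ball 0 R"
        using Ln_1_plus_holomorphic [OF m]
        by (auto intro!: holomorphic_intros simp: L_def o_def)
    next
      fix z :: complex assume z: "z \<in> ball 0 R"
      hence z': "- z \<in> ball 0 R" by simp
      show "ds_factor n z = exp (L (Suc n) (- z) - L (Suc n) z + 2 * z)"
        unfolding ds_factor_def exp_add exp_diff L_def exp_Ln_1_plus [OF m z] exp_Ln_1_plus [OF m z']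
        by (simp only: power_divide minus_divide_left [symmetric] diff_conv_add_uminus)
      define E where "E x = L (Suc n) x - x + x\<^sup>2 / (2 * of_nat (Suc n))" for x
      have E: "norm (E x) \<le> 2 * R ^ 3 / real n ^ 2" if "x \<in> ball 0 R" for x
      proof -
        have "norm (E x) \<le> 2 * R ^ 3 / real (Suc n) ^ 2"
          unfolding E_def L_def by (rule Ln_1_plus_bound [OF m that])
        also have "\<dots> \<le> 2 * R ^ 3 / real n ^ 2"
          using \<open>n > 0\<close> \<open>R > 0\<close> by (intro frac_le power_mono) auto
        finally show ?thesis .
      qed
      have "L (Suc n) (- z) - L (Suc n) z + 2 * z = E (- z) - E z"
        by (simp add: E_def)
      also have "norm \<dots> \<le> norm (E (- z)) + norm (E z)"
        by (rule norm_triangle_ineq4)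
      also have "\<dots> \<le> 2 * R ^ 3 / real n ^ 2 + 2 * R ^ 3 / real n ^ 2"
        by (intro add_mono E z z')
      finally show "norm (L (Suc n) (- z) - L (Suc n) z + 2 * z) \<le> (4 * R ^ 3) / real n ^ 2"
        by simp
    qed
  qed
  thus ?thesis
    by (intro exI [of _ "\<lambda>n x. L (Suc n) (- x) - L (Suc n) x + 2 * x"]) blast
qed

lemma convergent_bd_pair: "convergent_prod (\<lambda>n. bd_pair n x)"
  by (rule convergent_prod_entire [of bd_pair]) (rule bd_pair_eq_exp)

lemma convergent_ds_factor: "convergent_prod (\<lambda>n. ds_factor n z)"
  by (rule convergent_prod_entire [of ds_factor]) (rule ds_factor_eq_exp)

text \<open>Valid at the poles too: there one pair is 0 by the convention for division by zero, and
  both sides are 0.\<close>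

lemma borwein_dykshoorn_eq: "borwein_dykshoorn x = prodinf (\<lambda>n. bd_pair n x)"
  using convergent_prod_LIMSEQ [OF convergent_bd_pair, of x]
  unfolding borwein_dykshoorn_def bd_factor_def [symmetric] prod_bd_factor by (rule limI)

lemma double_sine_eq: "double_sine z = exp z * prodinf (\<lambda>n. ds_factor n z)"
  by (simp add: double_sine_def ds_factor_def)

section \<open>Meromorphy of the two functions\<close>

lemma holomorphic_on_UNIV_imp_meromorphic: "f holomorphic_on UNIV \<Longrightarrow> f meromorphic_on UNIV"
  by (simp add: analytic_on_imp_meromorphic_on analytic_on_open)

lemma one_plus_divide_meromorphic: "(\<lambda>x. 1 + x / of_nat k) meromorphic_on UNIV"
  by (rule holomorphic_on_UNIV_imp_meromorphic)
    (simp add: holomorphic_on_add holomorphic_on_mult divide_inverse)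

lemma one_minus_divide_meromorphic: "(\<lambda>x. 1 - x / of_nat k) meromorphic_on UNIV"
  by (rule holomorphic_on_UNIV_imp_meromorphic)
    (simp add: holomorphic_on_diff holomorphic_on_mult divide_inverse)

lemma borwein_dykshoorn_meromorphic: "borwein_dykshoorn meromorphic_on UNIV"
proof -
  have factor: "bd_factor k meromorphic_on UNIV" for k
    unfolding bd_factor_def [abs_def]
    by (rule meromorphic_on_powi) (rule one_plus_divide_meromorphic)
  have mero: "bd_pair n meromorphic_on UNIV" for n
    unfolding bd_pair_def [abs_def] by (rule meromorphic_on_mult) (rule factor)+
  have "(\<lambda>x. prodinf (\<lambda>n. bd_pair n x)) meromorphic_on UNIV"
    by (rule prodinf_meromorphic [of bd_pair]) (erule bd_pair_eq_exp, rule mero)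
  thus ?thesis
    unfolding borwein_dykshoorn_eq [abs_def] .
qed

lemma double_sine_meromorphic: "double_sine meromorphic_on UNIV"
proof -
  have exp: "(\<lambda>z. exp (c * z)) meromorphic_on UNIV" for c :: complex
    by (rule holomorphic_on_UNIV_imp_meromorphic)
      (rule holomorphic_on_exp'; simp add: holomorphic_on_mult)
  have mero: "ds_factor n meromorphic_on UNIV" for n
    unfolding ds_factor_def [abs_def]
    by (rule meromorphic_on_mult [OF meromorphic_on_power [OF meromorphic_on_divide
          [OF one_minus_divide_meromorphic one_plus_divide_meromorphic]] exp])
  have "(\<lambda>z. prodinf (\<lambda>n. ds_factor n z)) meromorphic_on UNIV"
    by (rule prodinf_meromorphic [of ds_factor]) (erule ds_factor_eq_exp, rule mero)
  from meromorphic_on_mult [OF exp [of 1] this] show ?thesis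
    unfolding double_sine_eq [abs_def] mult_1 .
qed

section \<open>The functional identity\<close>

lemma one_plus_divide_nonzero:
  assumes "x \<notin> (\<int> :: complex set)"
  shows "1 + x / of_nat k \<noteq> 0"
proof
  assume *: "1 + x / of_nat k = 0"
  \<comment> \<open>For \<open>k = 0\<close> the quotient is 0 by convention, so the sum would be
    1.\<close>
  hence "k \<noteq> 0" by (intro notI) simp
  with * have "x = - of_nat k" by (simp add: field_simps add_eq_0_iff)
  with assms show False by simp
qed

lemma bd_pair_nonzero: "x \<notin> \<int> \<Longrightarrow> bd_pair n x \<noteq> 0"
  using one_plus_divide_nonzero [of x] unfolding bd_pair_eq
  by (simp only: divide_eq_0_iff power_eq_0_iff) blast

lemma ds_factor_nonzero: "x \<notin> \<int> \<Longrightarrow> ds_factor n x \<noteq> 0"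
  using one_plus_divide_nonzero [of x "Suc n"] one_plus_divide_nonzero [of "- x" "Suc n"]
  by (simp add: ds_factor_def del: of_nat_Suc)

text \<open>
  The factors with base \<open>1 \<plusminus> x / (2*n+3)\<close> cancel. Those with base \<open>1 \<plusminus> x / (2*n+2)\<close> occur
  twice with exponent \<open>2*n+2\<close>, once from either function, which gives the fourth power.
\<close>

lemma bd_pair_Suc_ds_factor:
  assumes "x \<notin> \<int>"
  shows "bd_pair (Suc n) x * ds_factor (2*n+1) x * ds_factor (2*n+2) x
           = bd_pair (Suc n) (- x) * ds_factor n (x / 2) ^ 4"
proof -
  let ?a = "1 + x / of_nat (2*n+2)" and ?b = "1 + (- x) / of_nat (2*n+2)"
  let ?c = "1 + x / of_nat (2*n+3)" and ?d = "1 + (- x) / of_nat (2*n+3)"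
  have nz: "?a \<noteq> 0" "?b \<noteq> 0" "?c \<noteq> 0" "?d \<noteq> 0"
    using assms by (intro one_plus_divide_nonzero; simp)+
  \<comment> \<open>The bases of the double sine at \<open>x / 2\<close> are those at
    \<open>x\<close> with even index.\<close>
  have half: "x / 2 / of_nat (Suc n) = x / of_nat (2*n+2)"
    by (simp add: field_simps)
  have idx: "2 * Suc n = 2*n+2" and idx': "2*n+2+1 = 2*n+3"
    by simp_all
  have p: "bd_pair (Suc n) x = ?c ^ (2*n+3) / ?a ^ (2*n+2)"
    "bd_pair (Suc n) (- x) = ?d ^ (2*n+3) / ?b ^ (2*n+2)"
    using bd_pair_eq [of "Suc n" x] bd_pair_eq [of "Suc n" "- x"] unfolding idx idx' .
  \<comment> \<open>\<open>ds_factor i\<close> has base index \<open>i + 1\<close>, so these two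
    carry the indices \<open>2*n+2\<close> and \<open>2*n+3\<close>.\<close>
  have s: "ds_factor (2*n+1) x = (?b / ?a) ^ (2*n+2) * exp (2 * x)"
    "ds_factor (2*n+2) x = (?d / ?c) ^ (2*n+3) * exp (2 * x)"
    by (simp_all add: ds_factor_def numeral_3_eq_3)
  have h: "ds_factor n (x / 2) = (?b / ?a) ^ (n+1) * exp x"
    unfolding ds_factor_def half by simp
  have e: "exp (2 * x) = exp x ^ 2"
    by (simp add: exp_double)
  \<comment> \<open>Naming the powers hides the symbolic exponents; what remains is a rational
    identity in \<open>A\<close>, \<open>B\<close>, \<open>C\<close>, \<open>D\<close> and
    \<open>t = exp x\<close>.\<close>
  define A B C D where "A = ?a ^ (2*n+2)" and "B = ?b ^ (2*n+2)"
    and "C = ?c ^ (2*n+3)" and "D = ?d ^ (2*n+3)"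
  note folds = A_def [symmetric] B_def [symmetric] C_def [symmetric] D_def [symmetric]
  have nz': "A \<noteq> 0" "B \<noteq> 0" "C \<noteq> 0" "D \<noteq> 0"
    unfolding A_def B_def C_def D_def using nz by (auto simp only: power_eq_0_iff)
  have exponents: "(n+1) * 4 = (2*n+2) * 2"
    by simp
  have "ds_factor n (x / 2) ^ 4 = ((?b / ?a) ^ (2*n+2)) ^ 2 * exp x ^ 4"
    unfolding h power_mult_distrib power_mult [symmetric] exponents ..
  hence h4: "ds_factor n (x / 2) ^ 4 = (B / A) ^ 2 * exp x ^ 4"
    unfolding power_divide folds .
  have "C / A * (B / A * t ^ 2) * (D / C * t ^ 2) = D / B * ((B / A) ^ 2 * t ^ 4)" for t
    using nz' by (simp add: divide_simps eval_nat_numeral)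
  thus ?thesis
    unfolding h4 p s e power_divide folds .
qed

text \<open>Each induction step multiplies by the preceding one-step identity. The
  \<open>2*n+1\<close> double sine factors cover the base indices 1 to \<open>2*n+1\<close>, exactly
  those in the pairs up to \<open>n\<close>.\<close>

lemma partial_products_identity:
  assumes "x \<notin> \<int>"
  shows "(\<Prod>j\<le>n. bd_pair j x) * (\<Prod>i<2*n+1. ds_factor i x)
           = exp (2 * x) * (\<Prod>j\<le>n. bd_pair j (- x)) * (\<Prod>i<n. ds_factor i (x / 2)) ^ 4"
proof (induction n)
  case 0
  \<comment> \<open>The pair \<open>bd_pair 0 x = 1 + x\<close> cancels the denominator of
    \<open>ds_factor 0 x\<close>; its exponential is the \<open>exp (2 * x)\<close> in the
    claim.\<close>
  have "1 + x \<noteq> 0"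
    using one_plus_divide_nonzero [OF assms, of 1] by simp
  then show ?case by (simp add: bd_pair_eq ds_factor_def)
next
  case (Suc n)
  have "(\<Prod>j\<le>Suc n. bd_pair j x) * (\<Prod>i<2 * Suc n + 1. ds_factor i x)
      = ((\<Prod>j\<le>n. bd_pair j x) * (\<Prod>i<2*n+1. ds_factor i x))
        * (bd_pair (Suc n) x * ds_factor (2*n+1) x * ds_factor (2*n+2) x)"
    by (simp add: mult_ac)
  also have "\<dots> = exp (2 * x) * (\<Prod>j\<le>Suc n. bd_pair j (- x)) * (\<Prod>i<Suc n. ds_factor i (x / 2)) ^ 4"
    unfolding Suc.IH bd_pair_Suc_ds_factor [OF assms] by (simp add: power_mult_distrib mult_ac)
  finally show ?case .
qed

lemma borwein_dykshoorn_double_sine: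
  assumes x: "x \<notin> \<int>"
  shows "borwein_dykshoorn x / borwein_dykshoorn (- x)
           = exp x * (double_sine (x / 2) ^ 4 / double_sine x)"
proof -
  define P where "P z = prodinf (\<lambda>n. ds_factor n z)" for z
  have bd: "(\<lambda>n. \<Prod>j\<le>n. bd_pair j z) \<longlonglongrightarrow> borwein_dykshoorn z" for z
    unfolding borwein_dykshoorn_eq by (rule convergent_prod_LIMSEQ [OF convergent_bd_pair])
  have ds: "(\<lambda>n. \<Prod>i<n. ds_factor i z) \<longlonglongrightarrow> P z" for z
    unfolding P_def LIMSEQ_lessThan_iff_atMost
    by (rule convergent_prod_LIMSEQ [OF convergent_ds_factor])
  have "strict_mono (\<lambda>n. 2 * n + 1 :: nat)"
    by (auto simp: strict_mono_def)
  from LIMSEQ_subseq_LIMSEQ [OF ds this]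
  have ds': "(\<lambda>n. \<Prod>i<2*n+1. ds_factor i z) \<longlonglongrightarrow> P z" for z
    by (simp add: o_def)
  \<comment> \<open>The limit is taken in the division-free form; nonvanishing of the limits enters
    only afterwards.\<close>
  have "borwein_dykshoorn x * P x = exp (2 * x) * borwein_dykshoorn (- x) * P (x / 2) ^ 4"
  proof (rule LIMSEQ_unique)
    show "(\<lambda>n. (\<Prod>j\<le>n. bd_pair j x) * (\<Prod>i<2*n+1. ds_factor i x)) \<longlonglongrightarrow> borwein_dykshoorn x * P x"
      by (intro tendsto_mult bd ds')
    show "(\<lambda>n. (\<Prod>j\<le>n. bd_pair j x) * (\<Prod>i<2*n+1. ds_factor i x))
        \<longlonglongrightarrow> exp (2 * x) * borwein_dykshoorn (- x) * P (x / 2) ^ 4"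
      unfolding partial_products_identity [OF x]
      by (intro tendsto_mult tendsto_const tendsto_power bd ds)
  qed
  \<comment> \<open>A convergent product of nonzero factors is nonzero, and off the integers no
    factor vanishes.\<close>
  moreover have "P x \<noteq> 0"
    unfolding P_def by (intro prodinf_nonzero convergent_ds_factor ds_factor_nonzero x)
  moreover have "borwein_dykshoorn (- x) \<noteq> 0"
    unfolding borwein_dykshoorn_eq
    by (intro prodinf_nonzero convergent_bd_pair bd_pair_nonzero) (use x in simp)
  ultimately have "borwein_dykshoorn x / borwein_dykshoorn (- x) = exp (2 * x) * P (x / 2) ^ 4 / P x"
    by (simp add: field_simps)
  \<comment> \<open>The four prefactors \<open>exp (x / 2)\<close> make up
    \<open>exp (2 * x)\<close>, while the outer \<open>exp x\<close> offsets the prefactor of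
    \<open>double_sine x\<close>.\<close>
  also have "\<dots> = exp x * ((exp (x / 2) * P (x / 2)) ^ 4 / (exp x * P x))"
  proof -
    have "exp (x / 2) ^ 4 = exp (2 * x)"
      by (simp flip: exp_of_nat_mult)
    thus ?thesis
      by (simp add: power_mult_distrib)
  qed
  also have "\<dots> = exp x * (double_sine (x / 2) ^ 4 / double_sine x)"
    by (simp add: double_sine_eq P_def)
  finally show ?thesis .
qed

section \<open>From the pointwise identity to the meromorphic one\<close>

lemma not_islimpt_Ints: "\<not> z islimpt (\<int> :: complex set)"
proof (rule discrete_imp_not_islimpt [of 1])
  fix a b :: complex assume "a \<in> \<int>" "b \<in> \<int>" "dist b a < 1"
  thus "b = a"
    by (auto elim!: Ints_cases simp: dist_norm simp flip: of_int_diff)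
qed simp

text \<open>At integers the bare quotients may involve division by zero. \<open>remove_sings\<close>
  replaces values by limits where these exist, so the last conjunct is the identity of meromorphic
  functions.\<close>

theorem theorem1:
  "borwein_dykshoorn meromorphic_on UNIV \<and>
   double_sine meromorphic_on UNIV \<and>
   (\<forall>x::complex. x \<notin> \<int> \<longrightarrow>
      borwein_dykshoorn x / borwein_dykshoorn (- x)
        = exp x * (double_sine (x / 2) ^ 4 / double_sine x)) \<and>
   remove_sings (\<lambda>x. borwein_dykshoorn x / borwein_dykshoorn (- x))
     = remove_sings (\<lambda>x. exp x * (double_sine (x / 2) ^ 4 / double_sine x))"
proof (intro conjI allI impI borwein_dykshoorn_meromorphic double_sine_meromorphic
    borwein_dykshoorn_double_sine ext remove_sings_cong refl)
  fix z :: complex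
  \<comment> \<open>The integers are discrete, so a punctured neighbourhood of any \<open>z\<close>,
    integer or not, avoids them.\<close>
  have "eventually (\<lambda>x. x \<notin> \<int>) (at z)"
    using not_islimpt_Ints by (simp add: islimpt_iff_eventually)
  thus "eventually (\<lambda>x. borwein_dykshoorn x / borwein_dykshoorn (- x)
      = exp x * (double_sine (x / 2) ^ 4 / double_sine x)) (at z)"
    by eventually_elim (rule borwein_dykshoorn_double_sine)
qed

end
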